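(* Let $n\ge 2$ and let $\Omega\subset\mathbb{R}^n$ be a compact convex domain of nonzero $n$-dimensional Lebesgue measure with $\mathcal{C}^k$ piecewise smooth boundary, $k\ge 1$. Let $y_1,\dots,y_N$ ($N\ge 2$) be distinct points in the interior $\Omega^{\mathrm{o}}$ of $\Omega$, let $w\in\mathbb{R}^N$, and let $c:\mathbb{R}^n\times\mathbb{R}^n\to[0,\infty)$ be a cost function that is positive, symmetric, satisfies the triangle inequality, is homogeneous and shift invariant (in the sense specified in the context). Then each Laguerre cell $A(y_i)$, $i=1,\dots,N$, is star-shaped in $\Omega$ with respect to the point $y_i$.
   Context: Assumptions on the cost $c$: (positivity) $c(x,y)\ge 0$, and $c(x,y)=0$ if and only if $x=y$; (symmetry) $c(x,y)=c(y,x)$; (triangle inequality) $c(x,y)\le c(x,z)+c(z,y)$; (homogeneity) $c(tx,ty)=|t|\,c(x,y)$ for all $t\in\mathbb{R}$; (shift invariance) $c(x+z,y+z)=c(x,y)$; all for all $x,y,z\in\mathbb{R}^n$. Laguerre cells of $\Omega$: $A(y_i)=\{x\in\Omega : c(x,y_i)-w_i\le c(x,y_j)-w_j \text{ for all } j\ne i\}$. $\mathcal{C}^k$ piecewise smooth boundary: $\partial\Omega=\bigcup_{m=1}^{M}\overline{\Gamma_m}$ with each $\Gamma_m$ a $\mathcal{C}^k$ $(n-1)$-dimensional surface; two of the $\overline{\Gamma_m}$ may intersect along a $\mathcal{C}^k$ $(n-2)$-dimensional surface, etc. A set is star-shaped with respect to a point $y$ if for each point $x$ of the set, the segment from $y$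 to $x$ is contained in the set (vacuously true for the empty set). *)

theory Defs
  imports "HOL-Analysis.Analysis"
begin

definition admissible_cost :: "('a::real_vector \<Rightarrow> 'a \<Rightarrow> real) \<Rightarrow> bool" where
  "admissible_cost c \<longleftrightarrow>
     (\<forall>x y. c x y \<ge> 0 \<and> (c x y = 0 \<longleftrightarrow> x = y)) \<and>
     (\<forall>x y. c x y = c y x) \<and>
     (\<forall>x y z. c x y \<le> c x z + c z y) \<and>
     (\<forall>t x y. c (t *\<^sub>R x) (t *\<^sub>R y) = \<bar>t\<bar> * c x y) \<and>
     (\<forall>x y z. c (x + z) (y + z) = c x y)"

definition laguerre_cell ::
  "('a \<Rightarrow> 'a \<Rightarrow> real) \<Rightarrow> 'a set \<Rightarrow> ('m::finite \<Rightarrow> 'a) \<Rightarrow> real ^ 'm \<Rightarrow> 'm \<Rightarrow> 'a set" where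
  "laguerre_cell c \<Omega> y w i =
     {x \<in> \<Omega>. \<forall>j. j \<noteq> i \<longrightarrow> c x (y i) - w $ i \<le> c x (y j) - w $ j}"

text \<open>Unlike \<^const>\<open>starlike\<close>, the centre is prescribed and the empty set is allowed.\<close>

definition star_shaped_wrt :: "'a::real_vector set \<Rightarrow> 'a \<Rightarrow> bool" where
  "star_shaped_wrt S y \<longleftrightarrow> (\<forall>x\<in>S. closed_segment y x \<subseteq> S)"

text \<open>\<open>k\<close>-fold continuous differentiability. It is meant for open \<open>U\<close>; as the domain is
  finite-dimensional, continuity of the derivative as an operator is the same as continuity of
  all directional derivatives.\<close>

primrec Ck_on ::
  "nat \<Rightarrow> ('a::euclidean_space \<Rightarrow> 'b::euclidean_space) \<Rightarrow> 'a set \<Rightarrow> bool" where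
  "Ck_on 0 f U \<longleftrightarrow> continuous_on U f"
| "Ck_on (Suc k) f U \<longleftrightarrow>
     (\<forall>x\<in>U. f differentiable (at x)) \<and>
     (\<forall>v. Ck_on k (\<lambda>x. frechet_derivative f (at x) v) U)"

text \<open>A \<open>d\<close>-dimensional \<open>C\<^sup>k\<close> surface is an embedded \<open>C\<^sup>k\<close> submanifold: locally a
  \<open>C\<^sup>k\<close> diffeomorphism of the ambient space carries it to a \<open>d\<close>-dimensional linear subspace.
  It has no boundary points of its own and need not be connected.\<close>

definition Ck_surface :: "nat \<Rightarrow> nat \<Rightarrow> 'a::euclidean_space set \<Rightarrow> bool" where
  "Ck_surface k d S \<longleftrightarrow>
     (\<forall>p\<in>S. \<exists>U V \<phi> \<psi> L. open U \<and> p \<in> U \<and> open (V :: 'a set) \<and>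
        homeomorphism U V \<phi> \<psi> \<and> Ck_on k \<phi> U \<and> Ck_on k \<psi> V \<and>
        subspace L \<and> dim L = d \<and> \<phi> ` (U \<inter> S) = V \<inter> L)"

text \<open>\<open>F d\<close> is the finite collection of \<open>d\<close>-dimensional pieces; those of top dimension
  \<open>n - 1\<close> are the \<open>\<Gamma>\<^sub>m\<close>. The closures of two distinct pieces of equal dimension \<open>d\<close> meet
  along finitely many closed pieces of dimension \<open>d - 1\<close>. Pieces of still smaller dimension, or
  none at all, are also allowed there: opposite side faces of a square pyramid meet only at the
  apex.\<close>

definition Ck_piecewise_smooth_boundary :: "nat \<Rightarrow> 'a::euclidean_space set \<Rightarrow> bool" where
  "Ck_piecewise_smooth_boundary k \<Omega> \<longleftrightarrow>
     (\<exists>F :: nat \<Rightarrow> 'a set set.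
        (\<forall>d < DIM('a). finite (F d) \<and> (\<forall>\<Gamma>\<in>F d. Ck_surface k d \<Gamma>)) \<and>
        frontier \<Omega> = (\<Union>\<Gamma>\<in>F (DIM('a) - 1). closure \<Gamma>) \<and>
        (\<forall>d < DIM('a). \<forall>\<Gamma>\<in>F d. \<forall>\<Gamma>'\<in>F d. \<Gamma> \<noteq> \<Gamma>' \<longrightarrow>
           (\<exists>G \<subseteq> (\<Union>e<d. F e). closure \<Gamma> \<inter> closure \<Gamma>' = (\<Union>\<Delta>\<in>G. closure \<Delta>))))"

end

theory Submission
  imports Defs
begin

text \<open>The cost is additive along line segments: a point \<open>z\<close> of the segment from
  \<open>y\<^sub>i\<close> to \<open>x\<close> satisfies \<open>c x y\<^sub>i = c x z + c z y\<^sub>i\<close>. Moving from \<open>x\<close> to \<open>z\<close> therefore lowers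
  the cost to \<open>y\<^sub>i\<close> by exactly \<open>c x z\<close>, whereas by the triangle inequality it lowers the cost
  to any other \<open>y\<^sub>j\<close> by at most \<open>c x z\<close>.\<close>

lemma admissible_cost_triangle:
  assumes "admissible_cost c"
  shows "c x y \<le> c x z + c z y"
  using assms unfolding admissible_cost_def by blast

text \<open>Shift invariance reduces \<open>c\<close> to the one-argument function
  \<open>c v 0\<close>, which acts as a norm whose distance is \<open>c\<close>.\<close>

lemma admissible_cost_eq_diff:
  assumes "admissible_cost c"
  shows "c x y = c (x - y) 0"
proof -
  have "c ((x - y) + y) (0 + y) = c (x - y) 0"
    using assms unfolding admissible_cost_def by blast
  then show ?thesis by simp
qed

lemma admissible_cost_scaleR_0:
  assumes "admissible_cost c"
  shows "c (t *\<^sub>R x) 0 = \<bar>t\<bar> * c x 0"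
proof -
  have "c (t *\<^sub>R x) (t *\<^sub>R 0) = \<bar>t\<bar> * c x 0"
    using assms unfolding admissible_cost_def by blast
  then show ?thesis by simp
qed

text \<open>Both \<open>x - z\<close> and \<open>z - y\<close> are multiples of
  \<open>x - y\<close>, with nonnegative factors that add up to 1.\<close>

lemma admissible_cost_closed_segment:
  assumes c: "admissible_cost c" and z: "z \<in> closed_segment y x"
  shows "c x y = c x z + c z y"
proof -
  obtain u where u: "0 \<le> u" "u \<le> 1" and z_eq: "z = (1 - u) *\<^sub>R y + u *\<^sub>R x"
    using z by (auto simp: closed_segment_def)
  have "x - z = (1 - u) *\<^sub>R (x - y)" and "z - y = u *\<^sub>R (x - y)"
    unfolding z_eq by (simp_all add: algebra_simps)
  \<comment> \<open>The bounds on \<open>u\<close> remove the absolute values that homogeneity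
    produces.\<close>
  then have "c x z = (1 - u) * c x y" and "c z y = u * c x y"
    using u by (simp_all add: admissible_cost_eq_diff[OF c, of x z]
        admissible_cost_eq_diff[OF c, of z y] admissible_cost_eq_diff[OF c, of x y]
        admissible_cost_scaleR_0[OF c])
  then show ?thesis by (simp add: algebra_simps)
qed

text \<open>Convexity keeps the segment in \<open>\<Omega>\<close>. The weights do not change from
  \<open>x\<close> to \<open>z\<close>, so only the drop in the costs matters.\<close>

lemma star_shaped_wrt_laguerre_cell:
  assumes c: "admissible_cost c" and "convex \<Omega>" and "y i \<in> \<Omega>"
  shows "star_shaped_wrt (laguerre_cell c \<Omega> y w i) (y i)"
  unfolding star_shaped_wrt_def
proof (intro ballI subsetI)
  fix x z
  assume x: "x \<in> laguerre_cell c \<Omega> y w i" and z: "z \<in> closed_segment (y i) x"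
  have "x \<in> \<Omega>"
    using x by (simp add: laguerre_cell_def)
  then have "z \<in> \<Omega>"
    using assms z closed_segment_subset by blast
  moreover have "c z (y i) - w $ i \<le> c z (y j) - w $ j" if "j \<noteq> i" for j
  proof -
    have "c x (y i) - w $ i \<le> c x (y j) - w $ j"
      using x that by (simp add: laguerre_cell_def)
    \<comment> \<open>Subtract \<open>c x z\<close> from both sides of the inequality at
      \<open>x\<close>.\<close>
    then show ?thesis
      using admissible_cost_closed_segment[OF c z] admissible_cost_triangle[OF c, of x "y j" z]
      by linarith
  qed
  ultimately show "z \<in> laguerre_cell c \<Omega> y w i"
    by (simp add: laguerre_cell_def)
qed

theorem corollary2p13:
  fixes \<Omega> :: "(real ^ 'n) set"
    and y :: "'m::finite \<Rightarrow> real ^ 'n"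
    and w :: "real ^ 'm"
    and c :: "real ^ 'n \<Rightarrow> real ^ 'n \<Rightarrow> real"
    and k :: nat
  assumes "CARD('n) \<ge> 2"
    and "compact \<Omega>" and "convex \<Omega>" and "measure lebesgue \<Omega> \<noteq> 0"
    and "k \<ge> 1" and "Ck_piecewise_smooth_boundary k \<Omega>"
    and "CARD('m) \<ge> 2" and "inj y" and "\<forall>i. y i \<in> interior \<Omega>"
    and "admissible_cost c"
  shows "\<forall>i. star_shaped_wrt (laguerre_cell c \<Omega> y w i) (y i)"
  using assms star_shaped_wrt_laguerre_cell interior_subset by blast

end
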